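(* Let $\mathcal{G}$ be a simple undirected graph on $n$ nodes with all degrees positive, let $\mathcal{L}=D^{-1}G$ be its normalized Laplacian matrix, and let $\mathbf{c},\mathbf{x}_0\in\mathbb{R}^n$ be arbitrary. Consider the system $\mathbf{x}[k+1]=\mathcal{L}\mathbf{x}[k]$, $\mathbf{x}[0]=\mathbf{x}_0$, $y[k]=\mathbf{c}^{\intercal}\mathbf{x}[k]$, and its sequence of observations $(y[k])_{k=0}^{2n-1}$. Define the $n\times n$ Hankel matrix $Y$ by $Y_{ij}=y[i+j]$ for $0\le i,j\le n-1$, and let $r$ be its rank. Then every eigenvalue of $\mathcal{L}$ lying in the support $\mathcal{S}_{\mu_{\mathcal{L}}}$ of the spectral measure is a root of the polynomial $$p_{\mathcal{L}}(x)=x^{r}+\alpha_{r-1}x^{r-1}+\cdots+\alpha_{1}x+\alpha_{0},$$ where the coefficients are given by $$\begin{bmatrix}\alpha_0\\ \alpha_1\\ \vdots\\ \alpha_{r-1}\end{bmatrix}=-\begin{bmatrix} y[0]&y[1]&\cdots&y[r-1]\\ y[1]&y[2]&\cdots&y[r]\\ \vdots&\vdots&\ddots&\vdots\\ y[r-1]&y[r]&\cdots&y[2r-2]\end{bmatrix}^{-1}\begin{bmatrix}y[r]\\ y[r+1]\\ \vdots\\ y[2r-1]\end{bmatrix}$$ (the $r\times r$ matrix here being invertible).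
   Context: $G$ is the adjacency matrix of the graph $\mathcal{G}$ and $D$ the diagonal matrix of node degrees, $[D]_{ii}=\sum_j [G]_{ij}$. The paper calls $\mathcal{L}=D^{-1}G$ the normalized Laplacian. It is diagonalizable with real eigenvalues: $\mathcal{L}=U\Lambda W$ with $\Lambda=\mathrm{diag}(\lambda_1,\ldots,\lambda_n)$ (eigenvalues listed with multiplicity), $U=[\mathbf{u}_1,\ldots,\mathbf{u}_n]$, and $W=U^{-1}$ with rows $\mathbf{w}_1^{\intercal},\ldots,\mathbf{w}_n^{\intercal}$. The weights are $\omega_i=\mathbf{c}^{\intercal}\mathbf{u}_i\mathbf{w}_i^{\intercal}\mathbf{x}_0$. The spectral measure is the signed measure $\mu_{\mathcal{L}}=\sum_{i=1}^n\omega_i\delta(z-\lambda_i)$ on $\mathbb{R}$, whose support is the set (of distinct real numbers) $$\mathcal{S}_{\mu_{\mathcal{L}}}=\Big\{\lambda_i\in\sigma(\mathcal{L}) : \sum_{j:\lambda_j=\lambda_i}\omega_j\neq 0\Big\}.$$ If $r=0$, the polynomial $p_{\mathcal{L}}$ is the constant $1$. *)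

theory Defs
  imports
    "Graph_Theory.Digraph"
    "Jordan_Normal_Form.Gauss_Jordan_Elimination"
    "Jordan_Normal_Form.DL_Rank"
    "Jordan_Normal_Form.Spectral_Radius"
begin

definition adjacency_mat :: "nat \<Rightarrow> (nat, 'e) pre_digraph \<Rightarrow> real mat" where
  "adjacency_mat n \<G> = mat n n (\<lambda>(i, j). if i \<rightarrow>\<^bsub>\<G>\<^esub> j then 1 else 0)"

definition degree_mat :: "nat \<Rightarrow> (nat, 'e) pre_digraph \<Rightarrow> real mat" where
  "degree_mat n \<G> = mat_diag n (\<lambda>i. \<Sum>j<n. adjacency_mat n \<G> $$ (i, j))"

definition normalized_laplacian :: "nat \<Rightarrow> (nat, 'e) pre_digraph \<Rightarrow> real mat" where
  "normalized_laplacian n \<G> = the (mat_inverse (degree_mat n \<G>)) * adjacency_mat n \<G>"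

definition spectral_weight ::
    "real mat \<Rightarrow> real mat \<Rightarrow> real vec \<Rightarrow> real vec \<Rightarrow> nat \<Rightarrow> real" where
  "spectral_weight U W c x0 i = (c \<bullet> col U i) * (row W i \<bullet> x0)"

text \<open>Support of the signed measure with mass \<open>\<omega> i\<close> at \<open>lam i\<close> for \<open>i < dim_row L\<close>;
  masses at coinciding points add up and may cancel.\<close>

definition spectral_support :: "real mat \<Rightarrow> (nat \<Rightarrow> real) \<Rightarrow> (nat \<Rightarrow> real) \<Rightarrow> real set" where
  "spectral_support L lam \<omega> =
    {lam i | i. i < dim_row L \<and> lam i \<in> spectrum L \<and>
       (\<Sum>j | j < dim_row L \<and> lam j = lam i. \<omega> j) \<noteq> 0}"

definition hankel_mat :: "nat \<Rightarrow> (nat \<Rightarrow> real) \<Rightarrow> real mat" where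
  "hankel_mat m y = mat m m (\<lambda>(i, j). y (i + j))"

definition hankel_coeffs :: "nat \<Rightarrow> (nat \<Rightarrow> real) \<Rightarrow> real vec" where
  "hankel_coeffs r y = - (the (mat_inverse (hankel_mat r y)) *\<^sub>v vec r (\<lambda>i. y (r + i)))"

definition hankel_poly :: "nat \<Rightarrow> (nat \<Rightarrow> real) \<Rightarrow> real poly" where
  "hankel_poly r y = monom 1 r + (\<Sum>i<r. monom (hankel_coeffs r y $ i) i)"

lemma jordan_matrix_diag_or_chain:
  assumes "0 \<notin> fst ` set n_as"
  shows "(\<forall>i<sum_list (map fst n_as). \<forall>j<sum_list (map fst n_as). i \<noteq> j \<longrightarrow> jordan_matrix n_as $$ (i,j) = 0) \<or>
    (\<exists>i a. Suc i < sum_list (map fst n_as) \<and> (\<forall>k<sum_list (map fst n_as).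
       jordan_matrix n_as $$ (k,i) = (if k = i then a else 0) \<and>
       jordan_matrix n_as $$ (k,Suc i) = (if k = Suc i then a else if k = i then 1 else (0::'a::zero_neq_one))))"
  using assms
proof (induction n_as)
  case Nil
  then show ?case by simp
next
  case (Cons na n_as)
  obtain m a where na: "na = (m,a)" by force
  let ?s = "sum_list (map fst n_as)"
  let ?J = "jordan_matrix n_as"
  have m: "m > 0" using Cons.prems na by auto
  have J: "jordan_matrix (na # n_as) $$ (i,j) =
      (if i < m then if j < m then jordan_block m a $$ (i,j) else 0
       else if j < m then 0 else ?J $$ (i - m, j - m))" if "i < m + ?s" "j < m + ?s" for i j
  proof -
    have d: "dim_row (diag_block_mat (map (\<lambda>(n,a). jordan_block n a) n_as)) = ?s"
      "dim_col (diag_block_mat (map (\<lambda>(n,a). jordan_block n a) n_as)) = ?s"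
      using jordan_matrix_dim[of n_as] unfolding jordan_matrix_def by auto
    show ?thesis using that d unfolding jordan_matrix_def na by (auto simp: Let_def)
  qed
  have s: "sum_list (map fst (na # n_as)) = m + ?s" using na by simp
  show ?case
  proof (cases "m = 1")
    case False
    hence "Suc 0 < m" using m by simp
    hence "Suc 0 < m + ?s \<and> (\<forall>k<m + ?s.
       jordan_matrix (na # n_as) $$ (k,0) = (if k = 0 then a else 0) \<and>
       jordan_matrix (na # n_as) $$ (k,Suc 0) = (if k = Suc 0 then a else if k = 0 then 1 else 0))"
      by (auto simp: J)
    thus ?thesis unfolding s by blast
  next
    case m1: True
    from Cons.IH Cons.prems consider
      (diag) "\<forall>i<?s. \<forall>j<?s. i \<noteq> j \<longrightarrow> ?J $$ (i,j) = 0"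
      | (chain) i b where "Suc i < ?s" "\<forall>k<?s. ?J $$ (k,i) = (if k = i then b else 0) \<and>
       ?J $$ (k,Suc i) = (if k = Suc i then b else if k = i then 1 else 0)"
      by auto
    thus ?thesis
    proof cases
      case diag
      have "\<forall>i<m + ?s. \<forall>j<m + ?s. i \<noteq> j \<longrightarrow> jordan_matrix (na # n_as) $$ (i,j) = 0"
        using diag by (auto simp: J m1)
      thus ?thesis unfolding s by blast
    next
      case chain
      have "Suc (Suc i) < m + ?s \<and> (\<forall>k<m + ?s.
       jordan_matrix (na # n_as) $$ (k,Suc i) = (if k = Suc i then b else 0) \<and>
       jordan_matrix (na # n_as) $$ (k,Suc (Suc i)) = (if k = Suc (Suc i) then b else if k = Suc i then 1 else 0))"
        using chain by (auto simp: J m1)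
      thus ?thesis unfolding s by blast
    qed
  qed
qed

lemma eigenvalue_real_if_symmetrizable:
  fixes M :: "real mat"
  assumes M: "M \<in> carrier_mat n n"
    and d: "\<And>i. i < n \<Longrightarrow> 0 < d i"
    and sym: "\<And>i j. i < n \<Longrightarrow> j < n \<Longrightarrow> d i * M $$ (i,j) = d j * M $$ (j,i)"
    and ev: "eigenvalue (map_mat complex_of_real M) k"
  shows "k \<in> \<real>"
proof -
  let ?d = "\<lambda>i. complex_of_real (d i)" and ?M = "\<lambda>i j. complex_of_real (M $$ (i,j))"
  from ev obtain v where v: "v \<in> carrier_vec n" "v \<noteq> 0\<^sub>v n"
    and Mv: "map_mat complex_of_real M *\<^sub>v v = k \<cdot>\<^sub>v v"
    using M unfolding eigenvalue_def eigenvector_def by auto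
  have row: "(\<Sum>j<n. ?M i j * v $ j) = k * v $ i" if "i < n" for i
    using arg_cong[OF Mv, of "\<lambda>u. u $ i"] that v M
    by (simp add: scalar_prod_def atLeast0LessThan)
  define N where "N = (\<Sum>i<n. d i * (cmod (v $ i))\<^sup>2)"
  define S where "S = (\<Sum>i<n. \<Sum>j<n. ?d i * ?M i j * cnj (v $ i) * v $ j)"
  have "S = (\<Sum>i<n. ?d i * cnj (v $ i) * (\<Sum>j<n. ?M i j * v $ j))"
    unfolding S_def by (simp add: sum_distrib_left mult_ac)
  also have "\<dots> = (\<Sum>i<n. k * complex_of_real (d i * (cmod (v $ i))\<^sup>2))"
  proof (rule sum.cong[OF refl])
    fix i assume "i \<in> {..<n}"
    hence "(\<Sum>j<n. ?M i j * v $ j) = k * v $ i" by (simp add: row)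
    thus "?d i * cnj (v $ i) * (\<Sum>j<n. ?M i j * v $ j) = k * complex_of_real (d i * (cmod (v $ i))\<^sup>2)"
      by (simp only: of_real_mult complex_norm_square mult_ac)
  qed
  also have "\<dots> = k * N" unfolding N_def by (simp add: sum_distrib_left)
  finally have SN: "S = k * N" .
  have "cnj S = (\<Sum>i<n. \<Sum>j<n. ?d i * ?M i j * v $ i * cnj (v $ j))"
    unfolding S_def by simp
  also have "\<dots> = (\<Sum>i<n. \<Sum>j<n. ?d j * ?M j i * v $ i * cnj (v $ j))"
    using sym by (intro sum.cong refl) (simp flip: of_real_mult)
  also have "\<dots> = S" unfolding S_def by (subst sum.swap) (simp add: mult_ac)
  finally have "cnj k * N = k * N" using SN by simp
  moreover have "N > 0"
  proof -
    obtain i where i: "i < n" "v $ i \<noteq> 0" using v by (metis carrier_vecD eq_vecI index_zero_vec)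
    show ?thesis unfolding N_def
      by (rule sum_pos2[of _ i]) (use i in \<open>auto simp: d less_imp_le[OF d]\<close>)
  qed
  ultimately show ?thesis by (simp add: Reals_cnj_iff)
qed

lemma symmetrizable_diagonalizable:
  fixes M :: "real mat"
  assumes M: "M \<in> carrier_mat n n"
    and d: "\<And>i. i < n \<Longrightarrow> 0 < d i"
    and sym: "\<And>i j. i < n \<Longrightarrow> j < n \<Longrightarrow> d i * M $$ (i,j) = d j * M $$ (j,i)"
  shows "\<exists>lam U W. similar_mat_wit M (mat_diag n lam) U W"
proof -
  let ?C = "map_mat complex_of_real M"
  have C: "?C \<in> carrier_mat n n" using M by simp
  obtain as where as: "char_poly ?C = (\<Prod>a\<leftarrow>as. [:- a, 1:])"
    using char_poly_factorized[OF C] by blast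
  have "set as \<subseteq> \<real>"
  proof
    fix a assume "a \<in> set as"
    hence "poly (char_poly ?C) a = 0" unfolding as by (simp add: poly_prod_list prod_list_zero_iff)
    thus "a \<in> \<real>"
      using eigenvalue_real_if_symmetrizable[OF M d sym] eigenvalue_root_char_poly[OF C] by blast
  qed
  hence as': "as = map complex_of_real (map Re as)"
    by (auto simp: map_idI o_def subset_iff intro!: map_idI[symmetric])
  interpret h: map_poly_inj_idom_hom complex_of_real ..
  have "map_poly complex_of_real (char_poly M) = (\<Prod>a\<leftarrow>as. [:- a, 1:])"
    using of_real_hom.char_poly_hom[OF M] as by metis
  also have "\<dots> = map_poly complex_of_real (\<Prod>a\<leftarrow>map Re as. [:- a, 1:])"
    by (subst as') (simp add: h.hom_prod_list o_def)
  finally have "char_poly M = (\<Prod>a\<leftarrow>map Re as. [:- a, 1:])" by simp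
  from jordan_nf_exists[OF M this] obtain n_as
    where "0 \<notin> fst ` set n_as" and "similar_mat M (jordan_matrix n_as)"
    unfolding jordan_nf_def by blast
  then obtain P Q where nz: "0 \<notin> fst ` set n_as" and wit: "similar_mat_wit M (jordan_matrix n_as) P Q"
    unfolding similar_mat_def by blast
  define J where "J = jordan_matrix n_as"
  have PQ: "P \<in> carrier_mat n n" "Q \<in> carrier_mat n n" "J \<in> carrier_mat n n"
      "Q * P = 1\<^sub>m n" "M = P * J * Q"
    using similar_mat_witD2[OF M wit] unfolding J_def by auto
  have sn: "sum_list (map fst n_as) = n" using PQ(3) unfolding J_def by auto
  have "M * P = P * J * (Q * P)" using PQ by (simp add: assoc_mult_mat[of _ n n _ n _ n])
  hence MP: "M * P = P * J" using PQ by simp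
  have MPij: "(\<Sum>j<n. M $$ (k,j) * P $$ (j,i)) = (\<Sum>j<n. P $$ (k,j) * J $$ (j,i))"
    if "k < n" "i < n" for k i
    using arg_cong[OF MP, of "\<lambda>A. A $$ (k,i)"] that M PQ(1,3)
    by (simp add: scalar_prod_def atLeast0LessThan)
  have "\<forall>i<n. \<forall>j<n. i \<noteq> j \<longrightarrow> J $$ (i,j) = 0"
  proof (rule ccontr)
    assume "\<not> ?thesis"
    with jordan_matrix_diag_or_chain[OF nz, unfolded sn, folded J_def] obtain i a
      where i: "Suc i < n" and Ji: "\<And>k. k < n \<Longrightarrow> J $$ (k,i) = (if k = i then a else 0)"
       and JSi: "\<And>k. k < n \<Longrightarrow> J $$ (k,Suc i) = (if k = Suc i then a else if k = i then 1 else 0)"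
      by blast
    define u where "u k = P $$ (k,i)" for k
    define w where "w k = P $$ (k,Suc i)" for k
    have u: "(\<Sum>j<n. M $$ (k,j) * u j) = a * u k" if "k < n" for k
    proof -
      have "(\<Sum>j<n. P $$ (k,j) * J $$ (j,i)) = (\<Sum>j<n. if j = i then a * u k else 0)"
        by (rule sum.cong) (auto simp: Ji u_def)
      thus ?thesis using MPij[OF that, of i] i by (simp add: u_def)
    qed
    have w: "(\<Sum>j<n. M $$ (k,j) * w j) = a * w k + u k" if "k < n" for k
    proof -
      have "(\<Sum>j<n. P $$ (k,j) * J $$ (j,Suc i)) =
          (\<Sum>j<n. (if j = Suc i then a * w k else 0) + (if j = i then u k else 0))"
        by (rule sum.cong) (auto simp: JSi u_def w_def)
      thus ?thesis using MPij[OF that, of "Suc i"] i by (simp add: w_def sum.distrib)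
    qed
    have "(\<Sum>k<n. d k * u k * (a * w k + u k)) = (\<Sum>k<n. \<Sum>j<n. d k * M $$ (k,j) * u k * w j)"
      by (simp add: w[symmetric] sum_distrib_left mult_ac)
    also have "\<dots> = (\<Sum>k<n. \<Sum>j<n. d j * M $$ (j,k) * u k * w j)"
      using sym by (intro sum.cong refl) simp
    also have "\<dots> = (\<Sum>j<n. d j * w j * (\<Sum>k<n. M $$ (j,k) * u k))"
      by (subst sum.swap) (simp add: sum_distrib_left mult_ac)
    also have "\<dots> = (\<Sum>k<n. d k * u k * (a * w k))"
      by (rule sum.cong) (simp_all add: u)
    finally have "(\<Sum>k<n. d k * (u k)\<^sup>2) = 0"
      by (simp add: algebra_simps sum.distrib power2_eq_square)
    hence "d k * (u k)\<^sup>2 = 0" if "k \<in> {..<n}" for k using that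
      by (subst (asm) sum_nonneg_eq_0_iff) (auto simp: less_imp_le[OF d])
    hence u0: "u k = 0" if "k < n" for k using d[OF that] that
      by (metis lessThan_iff mult_eq_0_iff order_less_irrefl power2_eq_square)
    have "(Q * P) $$ (i,i) = (\<Sum>k<n. Q $$ (i,k) * u k)"
      using PQ(1,2) i by (simp add: scalar_prod_def atLeast0LessThan u_def)
    thus False using PQ(4) i u0 by simp
  qed
  hence "J = mat_diag n (\<lambda>i. J $$ (i,i))"
    using PQ(3) by (intro eq_matI) (auto simp: mat_diag_def)
  with wit[folded J_def] have "similar_mat_wit M (mat_diag n (\<lambda>i. J $$ (i,i))) P Q" by simp
  thus ?thesis by blast
qed

text \<open>The factorisation of the normalized Laplacian into \<open>U * mat_diag n lam * W\<close> with
  real \<open>lam\<close> and \<open>W\<close> inverse to \<open>U\<close> always exists, so it may be fixed without loss of generality.\<close>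

lemma normalized_laplacian_diagonalizable:
  assumes "graph \<G>" and "verts \<G> = {..<n}"
    and pos: "\<And>i. i < n \<Longrightarrow> 0 < degree_mat n \<G> $$ (i, i)"
  shows "\<exists>lam U W. similar_mat_wit (normalized_laplacian n \<G>) (mat_diag n lam) U W"
proof -
  interpret graph \<G> by fact
  define d where "d i = degree_mat n \<G> $$ (i,i)" for i
  have D: "degree_mat n \<G> = mat_diag n d" unfolding d_def degree_mat_def
    by (intro eq_matI) (auto simp: mat_diag_def)
  have d: "0 < d i" if "i < n" for i using pos that unfolding d_def by simp
  have inv: "mat_diag n d * mat_diag n (\<lambda>i. inverse (d i)) = 1\<^sub>m n"
     "mat_diag n (\<lambda>i. inverse (d i)) * mat_diag n d = 1\<^sub>m n"
    unfolding mat_diag_diag using d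
    by (auto intro!: eq_matI simp: mat_diag_def less_imp_neq[symmetric])
  hence "mat_diag n d \<in> Units (ring_mat TYPE(real) n ())"
    unfolding Units_def ring_mat_simps using mat_diag_dim by blast
  then obtain B where B: "mat_inverse (mat_diag n d) = Some B"
    using mat_inverse(1)[OF mat_diag_dim, of n d "()"] by fastforce
  have B': "B * mat_diag n d = 1\<^sub>m n" "B \<in> carrier_mat n n"
    using mat_inverse(2)[OF mat_diag_dim B] by auto
  let ?E = "mat_diag n (\<lambda>i. inverse (d i))"
  have "B = B * (mat_diag n d * ?E)" unfolding inv(1) using B'(2) by simp
  also have "\<dots> = (B * mat_diag n d) * ?E"
    by (rule assoc_mult_mat[symmetric, OF B'(2) mat_diag_dim mat_diag_dim])
  also have "\<dots> = ?E" unfolding B'(1) by (rule left_mult_one_mat[OF mat_diag_dim])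
  finally have "B = ?E" .
  hence L: "normalized_laplacian n \<G> =
      mat n n (\<lambda>(i,j). inverse (d i) * adjacency_mat n \<G> $$ (i,j))"
    unfolding normalized_laplacian_def D B
    by (simp add: mat_diag_mult_left[of _ n n] adjacency_mat_def)
  have sym: "adjacency_mat n \<G> $$ (i,j) = adjacency_mat n \<G> $$ (j,i)" if "i < n" "j < n" for i j
    using that sym_arcs unfolding symmetric_def adjacency_mat_def by (auto dest: symD)
  show ?thesis
    by (rule symmetrizable_diagonalizable[where d = d])
      (use d sym in \<open>auto simp: L less_imp_neq[symmetric]\<close>)
qed

end

theory Submission
  imports Defs "Jordan_Normal_Form.DL_Rank_Submatrix"
begin

text \<open>Grouping equal eigenvalues, the observations are \<open>y k = (\<Sum>s\<in>S. m s * s ^ k)\<close>, where \<open>S\<close> is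
  the support and every \<open>m s\<close> is nonzero. Pairing such a combination of powers with the Lagrange
  polynomials of \<open>S\<close> shows that \<open>(\<Sum>s\<in>S. a s * s ^ i) = 0\<close> for all \<open>i < card S\<close> forces \<open>a = 0\<close> on \<open>S\<close>.
  With \<open>a s = m s * p s\<close> for a polynomial \<open>p\<close> of degree less than \<open>card S\<close>, this makes the Hankel matrix of
  size \<open>card S\<close> nonsingular; since the full Hankel matrix is also a sum of \<open>card S\<close> matrices of rank one,
  \<open>r = card S\<close>. The linear system for the coefficients then says the same with \<open>p\<close> the
  monic polynomial of the theorem, so that polynomial vanishes on \<open>S\<close>.\<close>

lemma power_sums_eq_0_imp_coeffs_eq_0:
  fixes a :: "'a::idom \<Rightarrow> 'a"
  assumes fin: "finite S"
    and zero: "\<And>i. i < card S \<Longrightarrow> (\<Sum>s\<in>S. a s * s ^ i) = 0"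
    and t: "t \<in> S"
  shows "a t = 0"
proof -
  \<comment> \<open>Up to a scalar, \<open>f\<close> is the Lagrange polynomial of \<open>t\<close>:
    it vanishes on the rest of \<open>S\<close> but not at \<open>t\<close>, and its degree
    \<open>card S - 1\<close> keeps all powers in the range of the hypothesis.\<close>
  define f where "f = (\<Prod>s\<in>S - {t}. [:- s, 1:])"
  have "degree f = card (S - {t})"
    unfolding f_def by (subst degree_prod_eq_sum_degree) auto
  hence deg: "degree f < card S" using card_Diff1_less[OF fin t] by simp
  have "(\<Sum>s\<in>S. a s * poly f s) = (\<Sum>s\<in>S. \<Sum>i\<le>degree f. coeff f i * (a s * s ^ i))"
    by (simp add: poly_altdef sum_distrib_left mult_ac)
  also have "\<dots> = (\<Sum>i\<le>degree f. coeff f i * (\<Sum>s\<in>S. a s * s ^ i))"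
    by (subst sum.swap) (simp add: sum_distrib_left)
  also have "\<dots> = 0" using deg by (intro sum.neutral) (auto simp: zero)
  finally have "(\<Sum>s\<in>S. a s * poly f s) = 0" .
  moreover have "(\<Sum>s\<in>S. a s * poly f s) = a t * poly f t + (\<Sum>s\<in>S - {t}. a s * poly f s)"
    using fin t by (rule sum.remove)
  moreover have "(\<Sum>s\<in>S - {t}. a s * poly f s) = 0"
    by (rule sum.neutral) (use fin in \<open>auto simp: f_def poly_prod prod_zero_iff\<close>)
  moreover have "poly f t \<noteq> 0" using fin by (auto simp: f_def poly_prod prod_zero_iff)
  ultimately show ?thesis by simp
qed

text \<open>Each \<open>s\<close> contributes an outer product, which has rank at most 1, and rank
  is subadditive.\<close>

lemma (in vec_space) rank_le_card_if_sum_of_products: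
  fixes f g :: "'s \<Rightarrow> nat \<Rightarrow> 'a" and S :: "'s set"
  assumes "finite S" and "A \<in> carrier_mat n nc"
    and "\<And>i j. i < n \<Longrightarrow> j < nc \<Longrightarrow> A $$ (i, j) = (\<Sum>s\<in>S. f s i * g s j)"
  shows "rank A \<le> card S"
  using assms
proof (induction S arbitrary: A rule: finite_induct)
  case empty
  hence "A = 0\<^sub>m n nc" by (intro eq_matI) auto
  thus ?case using rank_0I by simp
next
  case (insert s S)
  define B where "B = mat n nc (\<lambda>(i, j). f s i * g s j)"
  define C where "C = mat n nc (\<lambda>(i, j). \<Sum>s\<in>S. f s i * g s j)"
  have B: "B \<in> carrier_mat n nc" and C: "C \<in> carrier_mat n nc" by (auto simp: B_def C_def)
  have "A = B + C"
    using insert by (intro eq_matI) (auto simp: B_def C_def)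
  hence "rank A \<le> rank B + rank C" using rank_subadditive[OF B C] by simp
  also have "rank B \<le> 1"
    by (rule rank_le_1_product_entries[OF B, of "f s" "g s"]) (auto simp: B_def)
  also have "rank C \<le> card S" using C by (rule insert.IH) (simp add: C_def)
  finally show ?case using insert.hyps by simp
qed

lemma pick_lessThan:
  assumes "i < q"
  shows "pick {..<q} i = i"
proof -
  have "{a \<in> {..<q}. a < i} = {..<i}" using assms by auto
  thus ?thesis using pick_card_in_set[of i "{..<q}"] assms by simp
qed

lemma submatrix_hankel_mat:
  assumes "q \<le> n"
  shows "submatrix (hankel_mat n y) {..<q} {..<q} = hankel_mat q y"
proof -
  have "{i. i < n \<and> i \<in> {..<q}} = {..<q}" using assms by auto
  thus ?thesis using assms
    by (intro eq_matI) (auto simp: submatrix_def hankel_mat_def pick_lessThan)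
qed

section \<open>Hankel matrices of a combination of powers with nonzero weights\<close>

context
  fixes S :: "real set" and m :: "real \<Rightarrow> real" and y :: "nat \<Rightarrow> real"
  assumes finite_S: "finite S" and m: "\<And>s. s \<in> S \<Longrightarrow> m s \<noteq> 0"
    and y: "\<And>k. y k = (\<Sum>s\<in>S. m s * s ^ k)"
begin

text \<open>The sums in the hypothesis are the power sums with weights
  \<open>m s * poly p s\<close>; these weights therefore vanish on \<open>S\<close>, and
  \<open>m s\<close> cancels.\<close>

lemma linear_recurrence_imp_root:
  fixes p :: "real poly"
  assumes "\<And>i. i < card S \<Longrightarrow> (\<Sum>j\<le>degree p. coeff p j * y (i + j)) = 0" and "s \<in> S"
  shows "poly p s = 0"
proof -
  have eq: "(\<Sum>s\<in>S. m s * poly p s * s ^ i) = (\<Sum>j\<le>degree p. coeff p j * y (i + j))" for i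
    unfolding poly_altdef y sum_distrib_left sum_distrib_right
    by (subst sum.swap) (simp add: power_add mult_ac)
  have "m s * poly p s = 0"
    by (rule power_sums_eq_0_imp_coeffs_eq_0[OF finite_S _ assms(2)]) (simp only: eq assms(1))
  thus ?thesis using m assms(2) by simp
qed

text \<open>A nonzero kernel vector, read as coefficients, would give a nonzero polynomial of degree
  below \<open>card S\<close> with all of \<open>S\<close> among its roots.\<close>

lemma det_hankel_mat_card_support_neq_0: "det (hankel_mat (card S) y) \<noteq> 0"
proof
  let ?q = "card S"
  assume "det (hankel_mat ?q y) = 0"
  then obtain v where v: "v \<in> carrier_vec ?q" "v \<noteq> 0\<^sub>v ?q"
    and Hv: "hankel_mat ?q y *\<^sub>v v = 0\<^sub>v ?q"
    using det_0_iff_vec_prod_zero[of "hankel_mat ?q y" ?q] by (auto simp: hankel_mat_def)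
  define p where "p = (\<Sum>j<?q. monom (v $ j) j)"
  have cp: "coeff p j = (if j < ?q then v $ j else 0)" for j
    by (simp add: p_def coeff_sum)
  \<comment> \<open>With \<open>?q\<close> positive, the strict degree bound below also covers the
    zero polynomial, whose degree counts as 0.\<close>
  have q: "0 < ?q" using v by (metis carrier_vecD eq_vecI gr0I index_zero_vec(2) less_nat_zero_code)
  have deg: "degree p < ?q"
    using q by (metis cp leading_coeff_neq_0 degree_0)
  have "(\<Sum>j\<le>degree p. coeff p j * y (i + j)) = 0" if "i < ?q" for i
  proof -
    have "(\<Sum>j\<le>degree p. coeff p j * y (i + j)) = (\<Sum>j<?q. coeff p j * y (i + j))"
      using deg by (intro sum.mono_neutral_left) (auto simp: coeff_eq_0)
    also have "\<dots> = (hankel_mat ?q y *\<^sub>v v) $ i"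
      using that v by (simp add: cp hankel_mat_def scalar_prod_def atLeast0LessThan mult_ac)
    finally show ?thesis using that Hv by simp
  qed
  hence roots: "S \<subseteq> {x. poly p x = 0}" using linear_recurrence_imp_root by blast
  have p: "p \<noteq> 0"
    using v cp by (metis carrier_vecD coeff_0 eq_vecI index_zero_vec)
  have "?q \<le> card {x. poly p x = 0}" using poly_roots_finite[OF p] roots by (rule card_mono)
  also have "\<dots> \<le> degree p" using p by (rule card_poly_roots_bound)
  finally show False using deg by simp
qed

text \<open>Upper bound: since \<open>s ^ (i + j) = s ^ i * s ^ j\<close>, the matrix is a sum of
  \<open>card S\<close> outer products. Lower bound: its leading minor of size \<open>card S\<close>
  is nonzero.\<close>

lemma rank_hankel_mat:
  assumes "card S \<le> n"
  shows "vec_space.rank n (hankel_mat n y) = card S"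
proof (rule antisym)
  interpret vec_space "TYPE(real)" n .
  have H: "hankel_mat n y \<in> carrier_mat n n" by (simp add: hankel_mat_def)
  show "rank (hankel_mat n y) \<le> card S"
    by (rule rank_le_card_if_sum_of_products[OF finite_S H,
        where f = "\<lambda>s i. m s * s ^ i" and g = "\<lambda>s j. s ^ j"])
      (simp add: hankel_mat_def y power_add mult_ac)
  have "{j. j < n \<and> j \<in> {..<card S}} = {..<card S}" using assms by auto
  thus "card S \<le> rank (hankel_mat n y)"
    using rank_gt_minor[OF H, of "{..<card S}" "{..<card S}"] det_hankel_mat_card_support_neq_0
    by (simp add: submatrix_hankel_mat[OF assms])
qed

text \<open>Ensures that \<open>the\<close> in \<open>hankel_coeffs\<close> unwraps a genuine
  inverse.\<close>

lemma hankel_mat_inverse_card_support: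
  obtains B where "mat_inverse (hankel_mat (card S) y) = Some B"
    "B \<in> carrier_mat (card S) (card S)"
    "hankel_mat (card S) y * B = 1\<^sub>m (card S)" "B * hankel_mat (card S) y = 1\<^sub>m (card S)"
proof -
  have H: "hankel_mat (card S) y \<in> carrier_mat (card S) (card S)" by (simp add: hankel_mat_def)
  obtain B where B: "mat_inverse (hankel_mat (card S) y) = Some B"
    using mat_inverse(1)[OF H, of "()"] det_non_zero_imp_unit[OF H det_hankel_mat_card_support_neq_0]
    by fastforce
  show thesis using that[OF B] mat_inverse(2)[OF H B] by blast
qed

lemma invertible_hankel_mat_card_support: "invertible_mat (hankel_mat (card S) y)"
proof -
  have "dim_row (hankel_mat k y) = k" "dim_col (hankel_mat k y) = k" for k
    by (simp_all add: hankel_mat_def)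
  with hankel_mat_inverse_card_support show ?thesis
    unfolding invertible_mat_def inverts_mat_def square_mat.simps by (metis carrier_matD(1))
qed

text \<open>The linear system solved by \<open>hankel_coeffs\<close>, completed by the leading
  coefficient 1, is the recurrence that forces roots on \<open>S\<close>.\<close>

lemma poly_hankel_poly_card_support:
  assumes "s \<in> S"
  shows "poly (hankel_poly (card S) y) s = 0"
proof (rule linear_recurrence_imp_root[OF _ assms])
  fix i assume i: "i < card S"
  let ?q = "card S" and ?p = "hankel_poly (card S) y"
  let ?H = "hankel_mat ?q y" and ?b = "vec ?q (\<lambda>i. y (?q + i))"
  obtain B where B: "mat_inverse ?H = Some B" "B \<in> carrier_mat ?q ?q" "?H * B = 1\<^sub>m ?q"
    using hankel_mat_inverse_card_support by metis
  have H: "?H \<in> carrier_mat ?q ?q" by (simp add: hankel_mat_def)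
  have co: "hankel_coeffs ?q y = - (B *\<^sub>v ?b)" by (simp add: hankel_coeffs_def B)
  have cc: "hankel_coeffs ?q y \<in> carrier_vec ?q" using B(2) by (simp add: co)
  have "?H *\<^sub>v (B *\<^sub>v ?b) = ?b"
    using assoc_mult_mat_vec[OF H B(2), of ?b] B(3) by simp
  moreover have "?H *\<^sub>v - (B *\<^sub>v ?b) = - (?H *\<^sub>v (B *\<^sub>v ?b))"
    using H B(2) by (intro eq_vecI) auto
  ultimately have "?H *\<^sub>v hankel_coeffs ?q y = - ?b" by (simp add: co)
  from arg_cong[OF this, of "\<lambda>v. v $ i"]
  have sys: "(\<Sum>j<?q. hankel_coeffs ?q y $ j * y (i + j)) = - y (i + ?q)"
    using i cc by (simp add: hankel_mat_def scalar_prod_def atLeast0LessThan mult_ac add_ac)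
  have cp: "coeff ?p j = (if j = ?q then 1 else if j < ?q then hankel_coeffs ?q y $ j else 0)" for j
    by (simp add: hankel_poly_def coeff_sum)
  \<comment> \<open>As the degree is exactly \<open>?q\<close>, the sum up to it is the left side of
    \<open>sys\<close> plus the leading term \<open>y (i + ?q)\<close>, and the two cancel.\<close>
  have "degree ?p = ?q"
    by (rule antisym) (auto intro!: degree_le le_degree simp: cp)
  thus "(\<Sum>j\<le>degree ?p. coeff ?p j * y (i + j)) = 0"
    using sys by (simp add: cp lessThan_Suc_atMost[symmetric])
qed

end

section \<open>Observations in terms of eigenvalues and weights\<close>

lemma dim_row_similar_mat_wit_mat_diag:
  assumes "similar_mat_wit L (mat_diag n lam) U W"
  shows "dim_row L = n"
  using carrier_matD(1)[OF similar_mat_witD(5)[OF refl assms]] by (simp add: mat_diag_def)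

text \<open>In the eigenbasis the dynamics is diagonal: each step multiplies coordinate
  \<open>i\<close> of the state by \<open>lam i\<close>.\<close>

lemma observation_eq_sum_spectral_weights:
  assumes L: "similar_mat_wit L (mat_diag n lam) U W"
    and c: "c \<in> carrier_vec n" and x0: "x0 \<in> carrier_vec n"
    and init: "x 0 = x0" and step: "\<And>k. x (Suc k) = L *\<^sub>v x k"
  shows "c \<bullet> x k = (\<Sum>i<n. spectral_weight U W c x0 i * lam i ^ k)"
proof -
  have dim: "dim_row L = n" using L by (rule dim_row_similar_mat_wit_mat_diag)
  have U: "U \<in> carrier_mat n n" and W: "W \<in> carrier_mat n n"
    and WU: "W * U = 1\<^sub>m n" and UW: "U * W = 1\<^sub>m n" and LUW: "L = U * mat_diag n lam * W"
    using similar_mat_witD[OF dim[symmetric] L] by blast+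
  \<comment> \<open>\<open>z k\<close> is the candidate for the coordinates of \<open>x k\<close>
    with respect to the columns of \<open>U\<close>; at \<open>k = 0\<close> it is
    \<open>W *\<^sub>v x0\<close>.\<close>
  define z where "z k = vec n (\<lambda>i. lam i ^ k * (row W i \<bullet> x0))" for k
  have z: "z k \<in> carrier_vec n" for k by (simp add: z_def)
  have "x k = U *\<^sub>v z k"
  proof (induction k)
    case 0
    have "z 0 = W *\<^sub>v x0" using W by (intro eq_vecI) (auto simp: z_def)
    thus ?case using assoc_mult_mat_vec[OF U W x0] UW x0 by (simp add: init)
  next
    case (Suc k)
    have "x (Suc k) = (U * mat_diag n lam) *\<^sub>v (W *\<^sub>v (U *\<^sub>v z k))"
      unfolding step Suc LUW
      by (rule assoc_mult_mat_vec[of _ n n _ n]) (use U W z in auto)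
    also have "W *\<^sub>v (U *\<^sub>v z k) = z k"
      using assoc_mult_mat_vec[OF W U z] WU z by simp
    also have "(U * mat_diag n lam) *\<^sub>v z k = U *\<^sub>v (mat_diag n lam *\<^sub>v z k)"
      by (rule assoc_mult_mat_vec[OF U mat_diag_dim z])
    also have "mat_diag n lam *\<^sub>v z k = z (Suc k)"
      by (intro eq_vecI)
        (auto simp: z_def mat_diag_def scalar_prod_def[of "vec _ _"]
          if_distrib[of "\<lambda>u. u * _"] cong: if_cong)
    finally show ?case .
  qed
  hence "c \<bullet> x k = (\<Sum>i<n. c $ i * (\<Sum>j<n. U $$ (i, j) * z k $ j))"
    using U z[of k] by (simp add: scalar_prod_def atLeast0LessThan)
  also have "\<dots> = (\<Sum>j<n. z k $ j * (\<Sum>i<n. c $ i * U $$ (i, j)))"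
    unfolding sum_distrib_left by (subst sum.swap) (simp add: mult_ac)
  also have "\<dots> = (\<Sum>j<n. spectral_weight U W c x0 j * lam j ^ k)"
    using U c by (intro sum.cong)
      (auto simp: z_def spectral_weight_def scalar_prod_def atLeast0LessThan)
  finally show ?thesis .
qed

text \<open>Weights at equal points merge into \<open>m s\<close>, and points where they cancel drop
  out. This supplies the nonzero weights on which the Hankel results rest.\<close>

lemma sum_group_fibres_nonzero:
  fixes f :: "'i \<Rightarrow> 'a" and w :: "'i \<Rightarrow> 'b::semiring_0"
  assumes "finite I"
  defines "m \<equiv> \<lambda>s. \<Sum>j | j \<in> I \<and> f j = s. w j"
  shows "(\<Sum>i\<in>I. w i * g (f i)) = (\<Sum>s | s \<in> f ` I \<and> m s \<noteq> 0. m s * g s)"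
proof -
  have "(\<Sum>i\<in>I. w i * g (f i)) = (\<Sum>s\<in>f ` I. \<Sum>i | i \<in> I \<and> f i = s. w i * g (f i))"
    using assms(1) by (rule sum.image_gen)
  also have "\<dots> = (\<Sum>s\<in>f ` I. m s * g s)"
    by (simp add: m_def sum_distrib_right)
  also have "\<dots> = (\<Sum>s | s \<in> f ` I \<and> m s \<noteq> 0. m s * g s)"
    using assms by (intro sum.mono_neutral_right) auto
  finally show ?thesis .
qed

theorem theorem3:
  fixes \<G> :: "(nat, 'e) pre_digraph" and n r :: nat
    and L U W :: "real mat" and lam \<omega> :: "nat \<Rightarrow> real"
    and c x0 :: "real vec" and x :: "nat \<Rightarrow> real vec" and y :: "nat \<Rightarrow> real"
  assumes graph: "graph \<G>" and nodes: "verts \<G> = {..<n}"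
    and degrees_pos: "\<And>i. i < n \<Longrightarrow> 0 < degree_mat n \<G> $$ (i, i)"
    and L: "L = normalized_laplacian n \<G>"
    and decomposition: "similar_mat_wit L (mat_diag n lam) U W"
    and c: "c \<in> carrier_vec n" and x0: "x0 \<in> carrier_vec n"
    and weights: "\<omega> = spectral_weight U W c x0"
    and init: "x 0 = x0" and step: "\<And>k. x (Suc k) = L *\<^sub>v x k"
    and observation: "\<And>k. y k = c \<bullet> x k"
    and r: "r = vec_space.rank n (hankel_mat n y)"
  shows "invertible_mat (hankel_mat r y) \<and>
    (\<forall>\<mu> \<in> spectral_support L lam \<omega>. poly (hankel_poly r y) \<mu> = 0)"
proof -
  define m where "m s = (\<Sum>j | j \<in> {..<n} \<and> lam j = s. \<omega> j)" for s
  define S where "S = {s. s \<in> lam ` {..<n} \<and> m s \<noteq> 0}"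
  have fin: "finite S" and m: "\<And>s. s \<in> S \<Longrightarrow> m s \<noteq> 0" by (auto simp: S_def)
  have y: "y k = (\<Sum>s\<in>S. m s * s ^ k)" for k
    using observation_eq_sum_spectral_weights[OF decomposition c x0 init step, of k]
      sum_group_fibres_nonzero[of "{..<n}" \<omega> "\<lambda>t. t ^ k" lam]
    by (simp add: observation weights S_def m_def)
  \<comment> \<open>There are at most \<open>n\<close> distinct eigenvalues, so the leading block of
    size \<open>card S\<close> fits into the full Hankel matrix.\<close>
  have "card S \<le> card (lam ` {..<n})" by (intro card_mono) (auto simp: S_def)
  hence "card S \<le> n" using card_image_le[of "{..<n}" lam] by simp
  hence r: "r = card S" using rank_hankel_mat[of S m, OF fin m y] r by simp
  have "dim_row L = n"
    using decomposition by (rule dim_row_similar_mat_wit_mat_diag)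
  hence "spectral_support L lam \<omega> \<subseteq> S"
    by (auto simp: spectral_support_def S_def m_def)
  moreover have "invertible_mat (hankel_mat r y)"
    unfolding r by (rule invertible_hankel_mat_card_support[OF fin m y])
  moreover have "poly (hankel_poly r y) s = 0" if "s \<in> S" for s
    unfolding r by (rule poly_hankel_poly_card_support[OF fin m y that])
  ultimately show ?thesis by blast
qed

end
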